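(* Let $q$ be a positive integer and let $\mu_q=\mu*\cdots*\mu$ be the $q$-fold Dirichlet convolution of the Möbius function with itself. Then for every positive integer $n$, $$\mu_q(n)=-2\sum_{i=0}^{\infty}(-1)^i(2\pi n)^{2i}\sum_{j=0}^{i}\frac{(-1)^j(2\pi)^{-2j}\zeta(2j)^{-q}}{(2i+1-2j)!}.$$
   Context: $\mu$ is the Möbius function, and $\mu_1=\mu$. The Dirichlet convolution of arithmetic functions $a,b$ is $(a*b)(n)=\sum_{k\mid n}a(k)b(n/k)$. $\zeta$ is the Riemann zeta function, with $\zeta(0)=-1/2$ (analytic continuation). The outer series over $i$ is summed in order of increasing $i$. *)

theory Defs
  imports
    "HOL-Complex_Analysis.Complex_Analysis"
    "HOL-Computational_Algebra.Squarefree"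
begin

definition moebius :: "nat \<Rightarrow> int" where
  "moebius n = (if squarefree n then (-1) ^ card (prime_factors n) else 0)"

definition dirichlet_conv :: "(nat \<Rightarrow> int) \<Rightarrow> (nat \<Rightarrow> int) \<Rightarrow> nat \<Rightarrow> int" where
  "dirichlet_conv a b n = (\<Sum>k | k dvd n. a k * b (n div k))"

(* The q-fold convolution of moebius with itself, for q >= 1. *)
definition moebius_conv :: "nat \<Rightarrow> nat \<Rightarrow> int" where
  "moebius_conv q = (dirichlet_conv moebius ^^ (q - 1)) moebius"

(* The last conjunct only fixes the value at the pole, so that the function is unique;
   existence and uniqueness are zeta_ex1 below. *)
definition is_zeta :: "(complex \<Rightarrow> complex) \<Rightarrow> bool" where
  "is_zeta f \<longleftrightarrow> f holomorphic_on - {1} \<and>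
     (\<forall>s. Re s > 1 \<longrightarrow> f s = (\<Sum>n. 1 / of_nat (Suc n) powr s)) \<and> f 1 = 0"

definition zeta :: "complex \<Rightarrow> complex" where
  "zeta = (THE f. is_zeta f)"

(* Well-definedness. Subtracting the Taylor polynomial of degree K of (n + 1)^(1 - s)
   around n and summing over n gives, with g s = (s - 1) * zeta s,
     g s = 1 + zrem K s - (SUM k = 2..K. ((1 - s) gchoose (k - 1)) / k * g (s + k - 1)),
   where zrem K is holomorphic for Re s > 1 - K. This continues g step by step. *)

definition zterm :: "nat \<Rightarrow> complex \<Rightarrow> nat \<Rightarrow> complex" where
  "zterm K a n = (of_nat n + 1) powr a -
     (\<Sum>k\<le>K. (a gchoose k) * of_nat n powr (a - of_nat k))"

definition zrem :: "nat \<Rightarrow> complex \<Rightarrow> complex" where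
  "zrem K s = (\<Sum>n. zterm K (1 - s) (Suc n))"

lemma zterm_bound:
  fixes a :: complex and n K :: nat and M :: real
  assumes a: "norm a \<le> M" and n: "n > 0"
  shows "norm (zterm K a n) \<le>
    ((M + K + 1) ^ Suc K * 2 powr (M + K + 1)) * real n powr (Re a - (K + 1))"
proof -
  define f where "f = (\<lambda>i (z::complex). (\<Prod>j=0..<i. a - of_nat j) * z powr (a - of_nat i))"
  define S where "S = closed_segment (1::complex) 2"
  have M0: "M \<ge> 0" using a norm_ge_zero order_trans by blast
  have S_eq: "\<exists>t. z = of_real t \<and> 1 \<le> t \<and> t \<le> 2" if "z \<in> S" for z
  proof -
    from that obtain u where u: "0 \<le> u" "u \<le> 1" "z = (1 - u) *\<^sub>R 1 + u *\<^sub>R 2"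
      unfolding S_def closed_segment_def by auto
    show ?thesis
      by (rule exI[of _ "1 + u"]) (use u in \<open>auto simp: scaleR_conv_of_real algebra_simps\<close>)
  qed
  let ?B = "(M + K + 1) ^ Suc K * 2 powr (M + K + 1)"
  have der: "(f i has_field_derivative f (Suc i) z) (at z within S)" if "z \<in> S" for i z
  proof -
    obtain t where t: "z = of_real t" "1 \<le> t" using S_eq[OF \<open>z \<in> S\<close>] by blast
    have "z \<notin> \<real>\<^sub>\<le>\<^sub>0" using t by (auto simp: complex_nonpos_Reals_iff)
    then have "((\<lambda>z. z powr (a - of_nat i)) has_field_derivative
        ((a - of_nat i) * z powr (a - of_nat i - 1))) (at z)"
      by (rule has_field_derivative_powr)
    then have "(f i has_field_derivative
        (\<Prod>j=0..<i. a - of_nat j) * ((a - of_nat i) * z powr (a - of_nat i - 1))) (at z)"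
      unfolding f_def by (rule DERIV_cmult)
    also have "(\<Prod>j=0..<i. a - of_nat j) * ((a - of_nat i) * z powr (a - of_nat i - 1))
        = f (Suc i) z"
      by (simp add: f_def algebra_simps)
    finally show ?thesis by (rule has_field_derivative_at_within)
  qed
  have B: "norm (f (Suc K) z) \<le> ?B" if "z \<in> S" for z
  proof -
    obtain t where t: "z = of_real t" "1 \<le> t" "t \<le> 2" using S_eq[OF \<open>z \<in> S\<close>] by blast
    have "norm (\<Prod>j=0..<Suc K. a - of_nat j) = (\<Prod>j=0..<Suc K. norm (a - of_nat j))"
      by (simp only: prod_norm)
    also have "\<dots> \<le> (\<Prod>j=0..<Suc K. M + K + 1)"
    proof (rule prod_mono)
      fix j assume "j \<in> {0..<Suc K}"
      then have "real j \<le> K" by auto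
      moreover have "norm (a - of_nat j) \<le> norm a + real j"
        using norm_triangle_ineq4[of a "of_nat j"] by simp
      ultimately show "0 \<le> norm (a - of_nat j) \<and> norm (a - of_nat j) \<le> M + K + 1"
        using a by simp
    qed
    also have "\<dots> = (M + K + 1) ^ Suc K" by simp
    finally have 1: "norm (\<Prod>j=0..<Suc K. a - of_nat j) \<le> (M + K + 1) ^ Suc K" .
    have "norm (z powr (a - of_nat (Suc K))) = t powr (Re a - Suc K)"
      using t by (subst norm_powr_real_powr) auto
    also have "\<dots> \<le> t powr (M + K + 1)"
      using t a abs_Re_le_cmod[of a] by (intro powr_mono) auto
    also have "\<dots> \<le> 2 powr (M + K + 1)"
      using t M0 by (intro powr_mono2) auto
    finally have 2: "norm (z powr (a - of_nat (Suc K))) \<le> 2 powr (M + K + 1)" .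
    show ?thesis unfolding f_def norm_mult
      using M0 by (intro mult_mono 1 2) auto
  qed
  let ?z = "1 + 1 / of_nat n :: complex"
  have zS: "?z \<in> S"
    unfolding S_def closed_segment_def using n
    by (auto simp: scaleR_conv_of_real intro!: exI[of _ "1 / real n"] simp: algebra_simps)
  have oS: "1 \<in> S" by (simp add: S_def)
  have T: "norm (f 0 ?z - (\<Sum>i\<le>K. f i 1 * (?z - 1) ^ i / fact i))
      \<le> ?B * norm (?z - 1) ^ Suc K / fact K"
    by (rule complex_Taylor[of S]) (use der B zS oS in \<open>auto simp: S_def\<close>)
  have npos: "of_nat n \<noteq> (0::complex)" using n by simp
  have n1: "of_nat n powr a * ?z powr a = (of_nat n + 1) powr a"
  proof -
    have "(of_nat n * ?z) powr a = of_nat n powr a * ?z powr a"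
      by (rule powr_times_real) auto
    moreover have "of_nat n * ?z = of_nat n + 1" using npos by (simp add: distrib_left)
    ultimately show ?thesis by simp
  qed
  have nk: "of_nat n powr a * (f k 1 * (?z - 1) ^ k / fact k)
      = (a gchoose k) * of_nat n powr (a - of_nat k)" for k
    using npos by (simp add: f_def gbinomial_prod_rev powr_diff powr_nat field_simps)
  have "zterm K a n = of_nat n powr a * (f 0 ?z - (\<Sum>i\<le>K. f i 1 * (?z - 1) ^ i / fact i))"
    unfolding zterm_def right_diff_distrib sum_distrib_left nk by (simp add: f_def n1)
  then have "norm (zterm K a n) =
      real n powr Re a * norm (f 0 ?z - (\<Sum>i\<le>K. f i 1 * (?z - 1) ^ i / fact i))"
    by (simp add: norm_mult norm_powr_real_powr)
  also have "\<dots> \<le> real n powr Re a * (?B * norm (?z - 1) ^ Suc K / fact K)"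
    by (intro mult_left_mono T) auto
  also have "\<dots> \<le> real n powr Re a * (?B * norm (?z - 1) ^ Suc K / 1)"
    by (intro mult_left_mono divide_left_mono) (use M0 in auto)
  also have "\<dots> = ?B * (real n powr Re a / real n ^ Suc K)"
    by (simp add: norm_divide field_simps)
  also have "real n powr Re a / real n ^ Suc K = real n powr (Re a - (K + 1))"
  proof -
    have "real n ^ Suc K = real n powr (K + 1)"
      using n powr_realpow[of "real n" "Suc K"] by (simp add: add.commute)
    then show ?thesis by (simp only: powr_diff)
  qed
  finally show ?thesis by simp
qed

lemma open_halfplane: "open {s. Re s > c}"
  by (rule open_halfspace_Re_gt)

lemma zrem_holomorphic: "zrem K holomorphic_on {s. Re s > 1 - real K}"
proof (rule holomorphic_uniform_sequence[where f = "\<lambda>N s. \<Sum>n<N. zterm K (1 - s) (Suc n)"])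
  show "open {s. Re s > 1 - real K}" by (rule open_halfplane)
  show "(\<lambda>s. \<Sum>n<N. zterm K (1 - s) (Suc n)) holomorphic_on {s. Re s > 1 - real K}" for N
    unfolding zterm_def gbinomial_prod_rev
    by (intro holomorphic_intros) (auto simp: complex_nonpos_Reals_iff)
  fix x assume "x \<in> {s. Re s > 1 - real K}"
  then have x: "Re x > 1 - real K" by simp
  define d where "d = (Re x - (1 - real K)) / 2"
  have d: "d > 0" "Re x - d > 1 - real K" using x by (auto simp: d_def field_simps)
  have Re_ge: "Re s \<ge> Re x - d" if "s \<in> cball x d" for s
    using that abs_Re_le_cmod[of "x - s"] by (auto simp: dist_norm)
  define M where "M = 1 + norm x + d"
  define C where "C = (M + K + 1) ^ Suc K * 2 powr (M + K + 1)"
  have M0: "M \<ge> 0" using d by (simp add: M_def)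
  then have C0: "C \<ge> 0" by (simp add: C_def)
  have "uniform_limit (cball x d) (\<lambda>N s. \<Sum>n<N. zterm K (1 - s) (Suc n))
          (\<lambda>s. \<Sum>n. zterm K (1 - s) (Suc n)) sequentially"
  proof (rule Weierstrass_m_test)
    fix n s assume s: "s \<in> cball x d"
    have "norm s \<le> norm x + d"
      using s norm_triangle_ineq2[of s x] by (auto simp: dist_norm norm_minus_commute)
    then have "norm (1 - s) \<le> M"
      using norm_triangle_ineq4[of 1 s] by (simp add: M_def)
    from zterm_bound[OF this, of "Suc n" K]
    have "norm (zterm K (1 - s) (Suc n)) \<le> C * real (Suc n) powr (Re (1 - s) - (K + 1))"
      by (simp add: C_def)
    also have "\<dots> \<le> C * real (Suc n) powr (- (Re x - d) - K)"
      using Re_ge[OF s] C0 by (intro mult_left_mono powr_mono) auto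
    finally show "norm (zterm K (1 - s) (Suc n)) \<le> C * real (Suc n) powr (- (Re x - d) - K)" .
  next
    have "summable (\<lambda>n. real n powr (- (Re x - d) - K))"
      using d by (subst summable_real_powr_iff) auto
    then have "summable (\<lambda>n. real (Suc n) powr (- (Re x - d) - K))"
      by (subst summable_Suc_iff)
    then show "summable (\<lambda>n. C * real (Suc n) powr (- (Re x - d) - K))"
      by (rule summable_mult)
  qed
  then have "uniform_limit (cball x d) (\<lambda>N s. \<Sum>n<N. zterm K (1 - s) (Suc n)) (zrem K) sequentially"
    by (simp add: zrem_def[abs_def])
  moreover have "cball x d \<subseteq> {s. Re s > 1 - real K}"
    using Re_ge d by force
  ultimately show "\<exists>d>0. cball x d \<subseteq> {s. Re s > 1 - real K} \<and>
      uniform_limit (cball x d) (\<lambda>N s. \<Sum>n<N. zterm K (1 - s) (Suc n)) (zrem K) sequentially"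
    using d by blast
qed

definition dseries :: "complex \<Rightarrow> complex" where
  "dseries s = (\<Sum>n. 1 / of_nat (Suc n) powr s)"

lemma dseries_sums:
  assumes "Re s > 1"
  shows "(\<lambda>n. of_nat (Suc n) powr (- s)) sums dseries s"
proof -
  have "summable (\<lambda>n. norm (of_nat (Suc n) powr (- s)))"
  proof -
    have "summable (\<lambda>n. real n powr (- Re s))"
      using assms by (subst summable_real_powr_iff) auto
    then have "summable (\<lambda>n. real (Suc n) powr (- Re s))" by (subst summable_Suc_iff)
    moreover have "norm (of_nat (Suc n) powr (- s)) = real (Suc n) powr (- Re s)" for n
      by (subst norm_powr_real_powr) auto
    ultimately show ?thesis by simp
  qed
  then have "summable (\<lambda>n. of_nat (Suc n) powr (- s))" by (rule summable_norm_cancel)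
  then show ?thesis
    unfolding dseries_def by (simp only: powr_minus_divide summable_sums)
qed

lemma gchoose_shift:
  fixes s :: complex
  assumes "k \<ge> 2" "s + of_nat k - 2 \<noteq> 0"
  shows "((1 - s) gchoose k) * z =
    - (((1 - s) gchoose (k - 1)) / of_nat k * ((s + of_nat k - 2) * z))"
proof -
  obtain j where j: "k = Suc j" using assms by (cases k) auto
  define A where "A = s + of_nat (Suc j) - 2"
  have "of_nat (Suc j) * ((1 - s) gchoose (Suc j)) = ((1 - s) - of_nat j) * ((1 - s) gchoose j)"
    using gbinomial_absorb_comp[of "1 - s" j] gbinomial_absorption[of j "1 - s"]
    by (metis mult_of_nat_commute of_nat_Suc gbinomial_mult_1 add_diff_cancel_left' left_diff_distrib')
  then have "((1 - s) gchoose (Suc j)) =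
      ((1 - s) - of_nat j) * ((1 - s) gchoose j) / of_nat (Suc j)"
    by (metis nonzero_mult_div_cancel_left of_nat_eq_0_iff nat.distinct(1))
  also have "(1 - s) - of_nat j = - A" by (simp add: A_def)
  finally show ?thesis unfolding j A_def[symmetric] by (simp del: of_nat_Suc add: mult_ac)
qed

lemma zrec_dseries:
  assumes s: "Re s > 1" and K: "K \<ge> 1"
  defines "G \<equiv> \<lambda>s. (s - 1) * dseries s"
  shows "G s = 1 + zrem K s -
    (\<Sum>k=2..K. ((1 - s) gchoose (k - 1)) / of_nat k * G (s + of_nat k - 1))"
proof -
  have "(\<lambda>n. of_nat (Suc n) powr (1 - s)) \<longlonglongrightarrow> 0"
  proof (rule tendsto_norm_zero_cancel)
    have "(\<lambda>n. real (Suc n) powr (1 - Re s)) \<longlonglongrightarrow> 0"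
      using s by real_asymp
    moreover have "norm (of_nat (Suc n) powr (1 - s)) = real (Suc n) powr (1 - Re s)" for n
      by (subst norm_powr_real_powr) auto
    ultimately show "(\<lambda>n. norm (of_nat (Suc n) powr (1 - s))) \<longlonglongrightarrow> 0" by simp
  qed
  from telescope_sums[OF this]
  have tel: "(\<lambda>n. of_nat (Suc (Suc n)) powr (1 - s) - of_nat (Suc n) powr (1 - s)) sums (-1)"
    by simp
  have "(\<lambda>n. \<Sum>k=1..K. ((1 - s) gchoose k) * of_nat (Suc n) powr (- (s + of_nat k - 1)))
      sums (\<Sum>k=1..K. ((1 - s) gchoose k) * dseries (s + of_nat k - 1))"
    by (intro sums_sum sums_mult dseries_sums) (use s in auto)
  note dif = sums_diff[OF tel this]
  have eq: "of_nat (Suc (Suc n)) powr (1 - s) - of_nat (Suc n) powr (1 - s) -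
      (\<Sum>k=1..K. ((1 - s) gchoose k) * of_nat (Suc n) powr (- (s + of_nat k - 1)))
      = zterm K (1 - s) (Suc n)" for n
  proof -
    have "(\<Sum>k\<le>K. ((1 - s) gchoose k) * of_nat (Suc n) powr (1 - s - of_nat k))
      = of_nat (Suc n) powr (1 - s) +
        (\<Sum>k=1..K. ((1 - s) gchoose k) * of_nat (Suc n) powr (1 - s - of_nat k))"
      unfolding atMost_atLeast0 by (subst sum.atLeast_Suc_atMost) auto
    then show ?thesis
      by (simp add: zterm_def algebra_simps)
  qed
  have "(\<lambda>n. zterm K (1 - s) (Suc n)) sums
     (-1 - (\<Sum>k=1..K. ((1 - s) gchoose k) * dseries (s + of_nat k - 1)))"
    using dif unfolding eq .
  then have R: "zrem K s = -1 - (\<Sum>k=1..K. ((1 - s) gchoose k) * dseries (s + of_nat k - 1))"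
    unfolding zrem_def by (simp add: sums_iff)
  have "(\<Sum>k=1..K. ((1 - s) gchoose k) * dseries (s + of_nat k - 1)) =
      (1 - s) * dseries s + (\<Sum>k=2..K. ((1 - s) gchoose k) * dseries (s + of_nat k - 1))"
    using K by (subst sum.atLeast_Suc_atMost) (auto simp: numeral_2_eq_2)
  also have "(\<Sum>k=2..K. ((1 - s) gchoose k) * dseries (s + of_nat k - 1)) =
      (\<Sum>k=2..K. - (((1 - s) gchoose (k - 1)) / of_nat k * G (s + of_nat k - 1)))"
  proof (rule sum.cong[OF refl])
    fix k assume k: "k \<in> {2..K}"
    have "Re (s + of_nat k - 2) \<noteq> 0" using s k by auto
    then have "s + of_nat k - 2 \<noteq> 0" by (metis zero_complex.simps(1))
    with k show "((1 - s) gchoose k) * dseries (s + of_nat k - 1) =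
        - (((1 - s) gchoose (k - 1)) / of_nat k * G (s + of_nat k - 1))"
      using gchoose_shift[of k s "dseries (s + of_nat k - 1)"]
      by (simp add: G_def algebra_simps)
  qed
  finally have "zrem K s = -1 - ((1 - s) * dseries s +
      - (\<Sum>k=2..K. ((1 - s) gchoose (k - 1)) / of_nat k * G (s + of_nat k - 1)))"
    using R unfolding sum_negf by (rule back_subst[where P = "\<lambda>x. zrem K s = -1 - x", rotated])
  moreover have "G s = - ((1 - s) * dseries s)" by (simp add: G_def algebra_simps)
  ultimately show ?thesis by simp
qed

(* zcont m agrees with (s - 1) * dseries s for Re s > 1 and is holomorphic for Re s > - m *)
primrec zcont :: "nat \<Rightarrow> complex \<Rightarrow> complex" where
  "zcont 0 s = 1 + zrem 1 s"
| "zcont (Suc m) s = 1 + zrem (m + 2) s -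
     (\<Sum>k=2..m+2. ((1 - s) gchoose (k - 1)) / of_nat k * zcont m (s + of_nat k - 1))"

lemma zcont_dseries: "Re s > 1 \<Longrightarrow> zcont m s = (s - 1) * dseries s"
proof (induction m arbitrary: s)
  case 0
  then show ?case using zrec_dseries[of s 1] by simp
next
  case (Suc m)
  have "(\<Sum>k=2..m+2. ((1 - s) gchoose (k - 1)) / of_nat k * zcont m (s + of_nat k - 1)) =
    (\<Sum>k=2..m+2. ((1 - s) gchoose (k - 1)) / of_nat k *
      ((s + of_nat k - 1 - 1) * dseries (s + of_nat k - 1)))"
    using Suc.prems by (intro sum.cong refl) (subst Suc.IH; auto)
  then have "zcont (Suc m) s = 1 + zrem (m + 2) s -
    (\<Sum>k=2..m+2. ((1 - s) gchoose (k - 1)) / of_nat k *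
      ((s + of_nat k - 1 - 1) * dseries (s + of_nat k - 1)))"
    by (simp only: zcont.simps)
  also have "\<dots> = (s - 1) * dseries s"
    by (rule zrec_dseries[OF Suc.prems, symmetric]) simp
  finally show ?case .
qed

lemma zcont_holomorphic: "zcont m holomorphic_on {s. Re s > - real m}"
proof (induction m)
  case 0
  have "(\<lambda>s. 1 + zrem 1 s) holomorphic_on {s. Re s > 0}"
    using zrem_holomorphic[of 1] by (intro holomorphic_intros) simp
  then show ?case by simp
next
  case (Suc m)
  have 1: "zrem (m + 2) holomorphic_on {s. Re s > - real (Suc m)}"
    using zrem_holomorphic[of "m + 2"] by (rule holomorphic_on_subset) auto
  have 2: "(\<lambda>s. zcont m (s + of_nat k - 1)) holomorphic_on {s. Re s > - real (Suc m)}"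
    if "k \<in> {2..m+2}" for k
  proof -
    have "(zcont m \<circ> (\<lambda>s. s + of_nat k - 1)) holomorphic_on {s. Re s > - real (Suc m)}"
      by (rule holomorphic_on_compose_gen[OF _ Suc.IH])
         (use that in \<open>auto intro!: holomorphic_intros\<close>)
    then show ?thesis by (simp add: o_def)
  qed
  have "(\<lambda>s. 1 + zrem (m + 2) s -
     (\<Sum>k=2..m+2. ((1 - s) gchoose (k - 1)) / of_nat k * zcont m (s + of_nat k - 1)))
     holomorphic_on {s. Re s > - real (Suc m)}"
    unfolding gbinomial_prod_rev by (intro holomorphic_intros 1 2) auto
  then show ?case by simp
qed

lemma zcont_unique:
  assumes "Re s > - real m" "Re s > - real n"
  shows "zcont m s = zcont n s"
proof -
  let ?S = "{s. Re s > max (- real m) (- real n)}"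
  show ?thesis
  proof (rule analytic_continuation_open[of "{s. Re s > 1}" ?S "zcont m" "zcont n"])
    show "{s. Re s > 1} \<noteq> {}" by (auto intro!: exI[of _ 2])
    show "open ?S" by (rule open_halfplane)
    show "connected ?S" by (intro convex_connected convex_halfspace_Re_gt)
    show "zcont m holomorphic_on ?S" "zcont n holomorphic_on ?S"
      by (rule holomorphic_on_subset[OF zcont_holomorphic]; force)+
  qed (use assms in \<open>auto simp: open_halfplane zcont_dseries\<close>)
qed

lemma is_zeta_unique:
  assumes "is_zeta f" "is_zeta g"
  shows "f = g"
proof
  fix s
  show "f s = g s"
  proof (cases "s = 1")
    case False
    show ?thesis
    proof (rule analytic_continuation_open[of "{s. Re s > 1}" "- {1}" f g])
      show "{s. Re s > 1} \<noteq> {}" by (auto intro!: exI[of _ 2])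
      show "connected (- {1::complex})"
        using connected_open_delete[OF open_UNIV connected_UNIV, of "1 :: complex"] by (simp add: Compl_eq_Diff_UNIV)
    qed (use assms False in \<open>auto simp: open_halfplane is_zeta_def\<close>)
  qed (use assms in \<open>auto simp: is_zeta_def\<close>)
qed

lemma is_zeta_ex: "\<exists>f. is_zeta f \<and> f 0 = - 1 / 2"
proof -
  define lev where "lev = (\<lambda>s. nat \<lceil>\<bar>Re s\<bar>\<rceil> + 1)"
  define f where "f = (\<lambda>s. if s = 1 then 0 else zcont (lev s) s / (s - 1))"
  have lev: "Re s > - real (lev s)" for s
    unfolding lev_def by linarith
  have f_eq: "f s = zcont m s / (s - 1)" if "s \<noteq> 1" "Re s > - real m" for m s
    using that zcont_unique[of "lev s" s m] lev by (simp add: f_def)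
  have "f holomorphic_on - {1}"
  proof (subst holomorphic_on_open, blast, intro ballI)
    fix x :: complex assume x: "x \<in> - {1}"
    let ?S = "{s. Re s > - real (lev x)} - {1}"
    have op: "open ?S" using open_halfplane by (intro open_delete) auto
    have "(\<lambda>s. zcont (lev x) s / (s - 1)) holomorphic_on ?S"
      by (intro holomorphic_intros holomorphic_on_subset[OF zcont_holomorphic]) auto
    then have "f holomorphic_on ?S"
      by (rule holomorphic_transform) (subst f_eq[where m = "lev x"]; auto)
    then show "\<exists>f'. (f has_field_derivative f') (at x)"
      using op x lev[of x] by (subst (asm) holomorphic_on_open) auto
  qed
  moreover have "f s = (\<Sum>n. 1 / of_nat (Suc n) powr s)" if s: "Re s > 1" for s
  proof -
    have "s \<noteq> 1" using s by auto
    then show ?thesis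
      using f_eq[of s 0] zcont_dseries[OF s, of 0] s by (simp add: dseries_def)
  qed
  moreover have "f 1 = 0" by (simp add: f_def)
  moreover have "f 0 = - 1 / 2"
  proof -
    have nz: "1 + of_nat n \<noteq> (0 :: complex)" for n
      using of_nat_neq_0[of n, where ?'a = complex] unfolding of_nat_Suc .
    have nz2: "2 + of_nat n \<noteq> (0 :: complex)" for n
    proof -
      have "2 + of_nat n = (of_nat (Suc (Suc n)) :: complex)" by simp
      then show ?thesis by (metis of_nat_neq_0)
    qed
    have "zterm 2 1 (Suc n) = 0" for n
      using nz by (simp add: zterm_def numeral_2_eq_2 gbinomial_prod_rev)
    then have 1: "zrem 2 0 = 0" by (simp add: zrem_def)
    have "zterm 1 0 (Suc n) = 0" for n
      using nz nz2 by (simp add: zterm_def)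
    then have 2: "zrem 1 1 = 0" by (simp add: zrem_def)
    have "zcont 1 0 = 1 / 2"
      using zcont.simps(2)[of 0 0] 1 2 by (simp add: numeral_2_eq_2)
    then show ?thesis using f_eq[of 0 1] by (simp del: zcont.simps)
  qed
  ultimately have "is_zeta f \<and> f 0 = - 1 / 2" unfolding is_zeta_def by simp
  then show ?thesis by (rule exI[of _ f])
qed

lemma zeta_ex1: "\<exists>!f. is_zeta f"
proof -
  obtain f where "is_zeta f" using is_zeta_ex by (elim exE conjE)
  then show ?thesis by (intro ex1I[of is_zeta f] is_zeta_unique[of _ f])
qed

lemma is_zeta_zeta: "is_zeta zeta"
  unfolding zeta_def by (rule theI'[OF zeta_ex1])

lemma zeta_0: "zeta 0 = - 1 / 2"
proof -
  obtain f where f: "is_zeta f" "f 0 = - 1 / 2" using is_zeta_ex by (elim exE conjE)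
  have "f = zeta" by (rule is_zeta_unique[OF f(1) is_zeta_zeta])
  with f(2) show ?thesis by simp
qed

end

(* Let s_m = (-1)^m (2 pi n)^(2m) / (2m+1)!, the coefficients of the entire series
   sin (2 pi n x) / (2 pi n x) in powers of x^2. The i-th term of the outer series is the i-th term
   of the Cauchy product of s with b_j = n^(2j) zeta(2j)^(-q), and
   b_j = SUM k. mu_q(k) (n/k)^(2j) for j >= 1. The frequencies k > n together with the constant
   b_0 form an absolutely convergent series, whose product with s has sum 0 because sin (2 pi n) = 0.
   For k <= n, r = (n/k)^2 >= 1 and the geometric series diverges, but the Cauchy product still
   converges: it is c_i = r^i SUM m<i. s_m / r^m, and the full sum SUM m. s_m / r^m = sin (2 pi k) / (2 pi k)
   vanishes, so c_i is minus a rapidly decreasing tail. From c_(i+1) = r (c_i + s_i) the sum of the c_i is 0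
   if r > 1, while for r = 1 telescoping i c_i gives - SUM m. m s_m = - 1/2. Only k = n contributes. *)
theory Submission
  imports Defs
begin

section \<open>The power series of sin x / x at multiples of 2 pi\<close>

definition sinc_coeff :: "real \<Rightarrow> nat \<Rightarrow> real" where
  "sinc_coeff x m = (-1) ^ m * x ^ (2 * m) / fact (2 * m + 1)"

lemma sinc_coeff_scale: "sinc_coeff x m * c ^ (2 * m) = sinc_coeff (x * c) m"
  by (simp add: sinc_coeff_def power_mult_distrib)

lemma sinc_coeff_sums:
  assumes "x \<noteq> 0"
  shows "sinc_coeff x sums (sin x / x)"
proof -
  have "(\<lambda>m. (-1) ^ m / fact (2 * m + 1) * x ^ (2 * m + 1) / x) sums (sin x / x)"
    by (intro sums_divide sin_paired)
  moreover have "(-1) ^ m / fact (2 * m + 1) * x ^ (2 * m + 1) / x = sinc_coeff x m" for m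
    using assms by (simp add: sinc_coeff_def del: fact_Suc)
  ultimately show ?thesis by simp
qed

lemma sinc_coeff_two_pi_sums:
  assumes "k \<ge> 1"
  shows "sinc_coeff (2 * pi * real k) sums 0"
  using sinc_coeff_sums[of "2 * pi * real k"] assms sin_npi[of "2 * k"]
  by (simp add: mult_ac)

lemma summable_abs_sinc_coeff: "summable (\<lambda>m. \<bar>sinc_coeff x m\<bar>)"
proof (rule summable_comparison_test_ev)
  have "(\<lambda>m. (x\<^sup>2) ^ m /\<^sub>R fact m) sums exp (x\<^sup>2)" by (rule exp_converges)
  then show "summable (\<lambda>m. (x\<^sup>2) ^ m / fact m)"
    by (simp add: sums_iff field_simps)
  show "\<forall>\<^sub>F m in sequentially. norm \<bar>sinc_coeff x m\<bar> \<le> (x\<^sup>2) ^ m / fact m"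
  proof (intro always_eventually allI)
    fix m
    have "norm \<bar>sinc_coeff x m\<bar> = (x\<^sup>2) ^ m / fact (2 * m + 1)"
      by (simp add: sinc_coeff_def abs_mult power_abs power_mult del: fact_Suc)
    also have "\<dots> \<le> (x\<^sup>2) ^ m / fact m"
      by (intro divide_left_mono fact_mono) (auto simp del: fact_Suc)
    finally show "norm \<bar>sinc_coeff x m\<bar> \<le> (x\<^sup>2) ^ m / fact m" .
  qed
qed

text \<open>The weight is absorbed into the argument, as c = (sqrt c)^2 and the coefficients carry
  even powers of x. With c = 2 this supplies the rate (1/2)^i in the tail bounds below.\<close>

lemma summable_abs_sinc_coeff_power: 
  assumes "c \<ge> 0"
  shows "summable (\<lambda>m. \<bar>sinc_coeff x m\<bar> * c ^ m)"
proof -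
  have "\<bar>sinc_coeff x m\<bar> * c ^ m = \<bar>sinc_coeff (x * sqrt c) m\<bar>" for m
    using assms by (simp add: sinc_coeff_scale[symmetric] abs_mult power_mult)
  then show ?thesis using summable_abs_sinc_coeff by simp
qed

text \<open>Since 2m / (2m+1)! = 1 / (2m)! - 1 / (2m+1)!, twice this series is cos x - sin x / x,
  which equals 1 - 0 at x = 2 pi n.\<close>

lemma weighted_sinc_coeff_sums:
  assumes "n \<ge> 1"
  shows "(\<lambda>m. real m * sinc_coeff (2 * pi * real n) m) sums (1 / 2)"
proof -
  let ?x = "2 * pi * real n"
  have cos: "cos ?x = 1" using cos_npi[of "2 * n"] by (simp add: mult_ac)
  have "(\<lambda>m. (-1) ^ m / fact (2 * m) * ?x ^ (2 * m) - sinc_coeff ?x m) sums (cos ?x - 0)"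
    by (intro sums_diff cos_paired sinc_coeff_two_pi_sums assms)
  from sums_divide[OF this, of 2]
  have "(\<lambda>m. ((-1) ^ m / fact (2 * m) * ?x ^ (2 * m) - sinc_coeff ?x m) / 2) sums (1 / 2)"
    using cos by simp
  moreover have "((-1) ^ m / fact (2 * m) * ?x ^ (2 * m) - sinc_coeff ?x m) / 2
      = real m * sinc_coeff ?x m" for m
  proof -
    define C where "C = (-1) ^ m * ?x ^ (2 * m)"
    define D where "D = 2 * real m + 1"
    have "(fact (2 * m + 1) :: real) = D * fact (2 * m)" by (simp add: D_def)
    moreover have "D \<noteq> 0" unfolding D_def by linarith
    ultimately have "C / fact (2 * m) = D * (C / fact (2 * m + 1))" by (simp del: fact_Suc)
    then have "(C / fact (2 * m) - C / fact (2 * m + 1)) / 2 = real m * (C / fact (2 * m + 1))"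
      by (simp add: D_def algebra_simps add_divide_distrib del: fact_Suc)
    then show ?thesis by (simp add: sinc_coeff_def C_def)
  qed
  ultimately show ?thesis by simp
qed

section \<open>Cauchy products with a geometric sequence\<close>

text \<open>The geometric sequence starts at j = 1, because the Dirichlet series represents
  zeta(2j)^(-q) only for j >= 1; the j = 0 term is treated separately. Hence
  \<open>geom_conv s r 0 = 0\<close>, which makes later index shifts free.\<close>

definition geom_conv :: "(nat \<Rightarrow> real) \<Rightarrow> real \<Rightarrow> nat \<Rightarrow> real" where
  "geom_conv s r i = (\<Sum>j\<le>i. s (i - j) * (if j = 0 then 0 else r ^ j))"

lemma geom_conv_Suc: "geom_conv s r (Suc i) = r * (geom_conv s r i + s i)"
proof -
  have "geom_conv s r (Suc i) = r * (\<Sum>j\<le>i. s (i - j) * r ^ j)"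
    unfolding geom_conv_def by (subst sum.atMost_Suc_shift) (simp add: sum_distrib_left mult_ac)
  also have "(\<Sum>j\<le>i. s (i - j) * r ^ j) =
      (\<Sum>j\<le>i. s (i - j) * (if j = 0 then 0 else r ^ j) + (if j = 0 then s i else 0))"
    by (intro sum.cong) auto
  also have "\<dots> = geom_conv s r i + s i"
    by (simp add: sum.distrib geom_conv_def)
  finally show ?thesis .
qed

lemma geom_conv_eq:
  assumes "r \<noteq> 0"
  shows "geom_conv s r i = r ^ i * (\<Sum>m<i. s m / r ^ m)"
proof (induction i)
  case 0
  then show ?case by (simp add: geom_conv_def)
next
  case (Suc i)
  then show ?case using assms by (simp add: geom_conv_Suc field_simps)
qed

text \<open>As the full series of s_m / r^m vanishes, its partial sum in \<open>geom_conv_eq\<close>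
  is minus a tail. Multiplied by r^i, that tail becomes the sum over l of s_(l+i) / r^l, bounded by
  the sum of the |s_(l+i)| because r >= 1. The weight 2^m then pays for the factor (1/2)^i.\<close>

lemma geom_conv_bound:
  assumes r: "r \<ge> 1" and s: "summable (\<lambda>m. \<bar>s m\<bar> * 2 ^ m)"
    and zero: "(\<lambda>m. s m / r ^ m) sums 0"
  shows "\<bar>geom_conv s r i\<bar> \<le> (\<Sum>m. \<bar>s m\<bar> * 2 ^ m) * (1 / 2) ^ i"
proof -
  have summ: "summable (\<lambda>m. s m / r ^ m)" using zero by (simp add: sums_iff)
  have tail: "(\<Sum>m<i. s m / r ^ m) = - (\<Sum>l. s (l + i) / r ^ (l + i))"
    using suminf_split_initial_segment[OF summ, of i] zero by (simp add: sums_iff)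
  have "geom_conv s r i = - (\<Sum>l. r ^ i * (s (l + i) / r ^ (l + i)))"
    using r summable_ignore_initial_segment[OF summ, of i]
    by (subst suminf_mult) (auto simp: geom_conv_eq tail)
  also have "(\<lambda>l. r ^ i * (s (l + i) / r ^ (l + i))) = (\<lambda>l. s (l + i) / r ^ l)"
    using r by (auto simp: power_add field_simps)
  finally have c: "\<bar>geom_conv s r i\<bar> = \<bar>\<Sum>l. s (l + i) / r ^ l\<bar>" by simp
  have s': "summable (\<lambda>l. \<bar>s (l + i)\<bar> * 2 ^ (l + i) * (1 / 2) ^ i)"
    by (intro summable_mult2 summable_ignore_initial_segment[OF s])
  have le: "norm (s (l + i) / r ^ l) \<le> \<bar>s (l + i)\<bar> * 2 ^ (l + i) * (1 / 2) ^ i" for l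
  proof -
    have "norm (s (l + i) / r ^ l) \<le> \<bar>s (l + i)\<bar> / 1"
      unfolding norm_divide using r by (intro frac_le) auto
    also have "\<dots> \<le> \<bar>s (l + i)\<bar> * 2 ^ l"
      by (simp add: mult_le_cancel_left1)
    also have "\<dots> = \<bar>s (l + i)\<bar> * 2 ^ (l + i) * (1 / 2) ^ i"
      by (simp add: power_add field_simps)
    finally show ?thesis .
  qed
  have "\<bar>geom_conv s r i\<bar> \<le> (\<Sum>l. \<bar>s (l + i)\<bar> * 2 ^ (l + i) * (1 / 2) ^ i)"
    unfolding c using norm_suminf_le[OF le s'] by simp
  also have "\<dots> = (\<Sum>l. \<bar>s (l + i)\<bar> * 2 ^ (l + i)) * (1 / 2) ^ i"
    by (intro suminf_mult2[symmetric] summable_ignore_initial_segment[OF s])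
  also have "(\<Sum>l. \<bar>s (l + i)\<bar> * 2 ^ (l + i)) \<le> (\<Sum>m. \<bar>s m\<bar> * 2 ^ m)"
    using suminf_split_initial_segment[OF s, of i] by (simp add: sum_nonneg)
  finally show ?thesis by (simp add: mult_right_mono)
qed

lemma summable_geom_conv:
  assumes "r \<ge> 1" "summable (\<lambda>m. \<bar>s m\<bar> * 2 ^ m)" "(\<lambda>m. s m / r ^ m) sums 0"
  shows "summable (geom_conv s r)"
  by (rule summable_comparison_test'[where g = "\<lambda>i. (\<Sum>m. \<bar>s m\<bar> * 2 ^ m) * (1 / 2) ^ i" and N = 0])
     (use geom_conv_bound[OF assms] in \<open>auto intro!: summable_mult summable_geometric\<close>)

text \<open>The sum C exists by the decay bound. Summing the recursion \<open>geom_conv_Suc\<close>,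
  with zero initial term and \<open>s sums 0\<close>, gives C = r * C.\<close>

lemma geom_conv_sums_0:
  assumes r: "r > 1" and s: "summable (\<lambda>m. \<bar>s m\<bar> * 2 ^ m)"
    and zero: "(\<lambda>m. s m / r ^ m) sums 0" "s sums 0"
  shows "geom_conv s r sums 0"
proof -
  have "summable (geom_conv s r)" using r by (intro summable_geom_conv s zero) auto
  then obtain C where C: "geom_conv s r sums C" by (auto simp: summable_def)
  have "(\<lambda>i. r * (geom_conv s r i + s i)) sums (r * (C + 0))"
    by (intro sums_mult sums_add C zero)
  then have "(\<lambda>i. geom_conv s r (Suc i)) sums (r * C)" by (simp add: geom_conv_Suc)
  then have "geom_conv s r sums (r * C)"
    by (subst (asm) sums_Suc_iff) (simp add: geom_conv_def)
  with C have "C = r * C" by (rule sums_unique2)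
  then have "C = 0" using r by simp
  with C show ?thesis by simp
qed

text \<open>For r = 1 the summed recursion only says C = C, so it is weighted by i: (i+1) c_(i+1) -
  i c_i = c_(i+1) + i s_i. The left side telescopes to 0 because c_i decays geometrically.\<close>

lemma geom_conv_1_sums:
  assumes s: "summable (\<lambda>m. \<bar>s m\<bar> * 2 ^ m)"
    and zero: "s sums 0" and w: "(\<lambda>m. real m * s m) sums w"
  shows "geom_conv s 1 sums - w"
proof -
  let ?c = "geom_conv s 1"
  have "summable ?c" by (intro summable_geom_conv s) (use zero in auto)
  then obtain C where C: "?c sums C" by (auto simp: summable_def)
  have lim: "(\<lambda>i. real i * ?c i) \<longlonglongrightarrow> 0"
  proof (rule Lim_null_comparison)
    let ?M = "\<Sum>m. \<bar>s m\<bar> * 2 ^ m"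
    show "\<forall>\<^sub>F i in sequentially. norm (real i * ?c i) \<le> ?M * (real i * (1 / 2) ^ i)"
    proof (intro always_eventually allI)
      fix i
      have "\<bar>?c i\<bar> \<le> ?M * (1 / 2) ^ i"
        by (rule geom_conv_bound[OF _ s]) (use zero in auto)
      then show "norm (real i * ?c i) \<le> ?M * (real i * (1 / 2) ^ i)"
        using mult_left_mono[of "\<bar>?c i\<bar>" "?M * (1 / 2) ^ i" "real i"]
        by (simp add: abs_mult mult_ac)
    qed
    have "(\<lambda>i. real i * (1 / 2) ^ i) \<longlonglongrightarrow> 0" by real_asymp
    then show "(\<lambda>i. ?M * (real i * (1 / 2) ^ i)) \<longlonglongrightarrow> 0" by (rule tendsto_mult_right_zero)
  qed
  have "(\<lambda>i. real (Suc i) * ?c (Suc i) - real i * ?c i) sums (0 - real 0 * ?c 0)"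
    by (rule telescope_sums[OF lim])
  then have "(\<lambda>i. (real (Suc i) * ?c (Suc i) - real i * ?c i) - real i * s i) sums (0 - w)"
    by (intro sums_diff w) simp
  moreover have "(real (Suc i) * ?c (Suc i) - real i * ?c i) - real i * s i = ?c (Suc i)" for i
    by (simp add: geom_conv_Suc algebra_simps)
  ultimately have "(\<lambda>i. ?c (Suc i)) sums - w" by simp
  then show ?thesis
    by (subst (asm) sums_Suc_iff) (simp add: geom_conv_def)
qed

text \<open>Dividing the m-th coefficient by r^m rescales the argument from 2 pi n to 2 pi k. Both
  vanishing sums therefore express sin (2 pi k) = sin (2 pi n) = 0.\<close>

lemma geom_conv_sinc_coeff_sums:
  assumes "1 \<le> k" "k \<le> n"
  shows "geom_conv (sinc_coeff (2 * pi * real n)) ((real n / real k)\<^sup>2) sums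
    (if k = n then - 1 / 2 else 0)"
proof -
  let ?s = "sinc_coeff (2 * pi * real n)" and ?r = "(real n / real k)\<^sup>2"
  have n: "n \<ge> 1" using assms by simp
  note s = summable_abs_sinc_coeff_power[of 2 "2 * pi * real n"]
  note zero = sinc_coeff_two_pi_sums[OF n]
  show ?thesis
  proof (cases "k = n")
    case True
    then show ?thesis
      using geom_conv_1_sums[OF s zero weighted_sinc_coeff_sums[OF n]] n by simp
  next
    case False
    have "?s m / ?r ^ m = sinc_coeff (2 * pi * real k) m" for m
    proof -
      have "?s m / ?r ^ m = ?s m * (real k / real n) ^ (2 * m)"
        by (simp add: power_mult power_divide)
      also have "\<dots> = sinc_coeff (2 * pi * real k) m"
        using n by (simp add: sinc_coeff_scale mult.assoc)
      finally show ?thesis .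
    qed
    then have "(\<lambda>m. ?s m / ?r ^ m) sums 0"
      using sinc_coeff_two_pi_sums[OF assms(1)] by simp
    moreover have "?r > 1" using assms False by (intro one_less_power) auto
    ultimately show ?thesis using geom_conv_sums_0[OF _ s _ zero] False by simp
  qed
qed

text \<open>For the absolutely convergent part of the sequence, made of the constant term and the
  frequencies k > n.\<close>

lemma cauchy_zero_sums:
  fixes s b :: "nat \<Rightarrow> real"
  assumes "summable (\<lambda>m. \<bar>s m\<bar>)" "summable (\<lambda>m. \<bar>b m\<bar>)" "s sums 0"
  shows "(\<lambda>i. \<Sum>j\<le>i. s (i - j) * b j) sums 0"
proof -
  have "(\<lambda>i. \<Sum>j\<le>i. b j * s (i - j)) sums (suminf b * suminf s)"
    by (rule Cauchy_product_sums) (use assms in auto)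
  then show ?thesis using assms(3) by (simp add: sums_iff mult.commute)
qed

section \<open>Powers of 1 / zeta as Dirichlet series\<close>

lemma moebius_prime_mult:
  assumes p: "prime p" and d: "\<not> p dvd d"
  shows "moebius (p * d) = - moebius d"
proof -
  have cop: "coprime p d" using p d by (simp add: prime_imp_coprime)
  have d0: "d \<noteq> 0" using d by (intro notI) simp
  have p0: "p \<noteq> 0" using p by auto
  have sq: "squarefree (p * d) \<longleftrightarrow> squarefree d"
    using cop squarefree_prime[OF p] by (auto intro: squarefree_mult_coprime dest: squarefree_multD)
  have "prime_factors (p * d) = insert p (prime_factors d)"
    using p p0 d0 by (simp add: prime_factors_product prime_prime_factors)
  moreover have "p \<notin> prime_factors d" using d by auto
  ultimately show ?thesis by (simp add: moebius_def sq)
qed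

text \<open>For n > 1 fix a prime p dividing n. Among the squarefree divisors, each d not divisible
  by p is paired with p * d, and the two values cancel.\<close>

lemma sum_moebius_divisors:
  assumes "n \<ge> 1"
  shows "(\<Sum>k | k dvd n. moebius k) = (if n = 1 then 1 else 0)"
proof (cases "n = 1")
  case True
  then show ?thesis by (simp add: moebius_def)
next
  case False
  then obtain p where p: "prime p" "p dvd n" using prime_factor_nat by blast
  define A where "A = {d. d dvd n \<and> squarefree d \<and> \<not> p dvd d}"
  have fin: "finite {d. d dvd n}" using assms by simp
  then have finA: "finite A" by (rule rev_finite_subset) (auto simp: A_def)
  have "{d. d dvd n \<and> squarefree d} = A \<union> (*) p ` A"
  proof (intro set_eqI iffI)
    fix d assume d: "d \<in> {d. d dvd n \<and> squarefree d}"
    show "d \<in> A \<union> (*) p ` A"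
    proof (cases "p dvd d")
      case True
      then obtain e where e: "d = p * e" by blast
      have "\<not> p dvd e"
      proof
        assume "p dvd e"
        then have "p ^ 2 dvd d" by (auto simp: e power2_eq_square)
        then have "p dvd 1" using d by (auto dest: squarefreeD)
        then show False using p by simp
      qed
      moreover have "squarefree e" using d e squarefree_multD(2) by blast
      moreover have "e dvd n" using d e dvd_mult_right by blast
      ultimately show ?thesis by (auto simp: A_def e)
    qed (use d in \<open>auto simp: A_def\<close>)
  next
    fix d assume "d \<in> A \<union> (*) p ` A"
    then show "d \<in> {d. d dvd n \<and> squarefree d}"
      using p by (auto simp: A_def prime_imp_coprime squarefree_prime intro!: divides_mult squarefree_mult_coprime)
  qed
  moreover have "A \<inter> (*) p ` A = {}" by (auto simp: A_def)
  ultimately have "(\<Sum>d | d dvd n \<and> squarefree d. moebius d) =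
      (\<Sum>d\<in>A. moebius d) + (\<Sum>d\<in>(*) p ` A. moebius d)"
    using finA by (simp add: sum.union_disjoint)
  also have "(\<Sum>d\<in>(*) p ` A. moebius d) = (\<Sum>d\<in>A. moebius (p * d))"
    using p by (subst sum.reindex) (auto simp: inj_on_def)
  also have "\<dots> = (\<Sum>d\<in>A. - moebius d)"
    by (intro sum.cong) (auto simp: A_def moebius_prime_mult p)
  finally have "(\<Sum>d | d dvd n \<and> squarefree d. moebius d) = 0" by (simp add: sum_negf)
  moreover have "(\<Sum>d | d dvd n \<and> squarefree d. moebius d) = (\<Sum>d | d dvd n. moebius d)"
    using fin by (intro sum.mono_neutral_left) (auto simp: moebius_def)
  ultimately show ?thesis using False by simp
qed

lemma dirichlet_conv_moebius_1:
  assumes "n \<ge> 1"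
  shows "dirichlet_conv moebius (\<lambda>_. 1) n = (if n = 1 then 1 else 0)"
  using sum_moebius_divisors[OF assms] by (simp add: dirichlet_conv_def)

text \<open>The double series over factor pairs (k, l) is regrouped by the product m = k * l, a pair
  being the same as m with a divisor k. Unconditional summability of reals is absolute, which makes
  the product family summable and the regrouping legitimate.\<close>

lemma dirichlet_series_conv:
  fixes a b :: "nat \<Rightarrow> int"
  assumes a: "(\<lambda>k. real_of_int (a k) / real k ^ s) summable_on {1..}"
    and b: "(\<lambda>k. real_of_int (b k) / real k ^ s) summable_on {1..}"
  shows "(\<lambda>k. real_of_int (dirichlet_conv a b k) / real k ^ s) summable_on {1..}" (is ?S)
    and "(\<Sum>\<^sub>\<infinity>k\<in>{1..}. real_of_int (dirichlet_conv a b k) / real k ^ s) =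
      (\<Sum>\<^sub>\<infinity>k\<in>{1..}. real_of_int (a k) / real k ^ s) * (\<Sum>\<^sub>\<infinity>k\<in>{1..}. real_of_int (b k) / real k ^ s)" (is ?E)
proof -
  let ?f = "\<lambda>k. real_of_int (a k) / real k ^ s" and ?g = "\<lambda>k. real_of_int (b k) / real k ^ s"
  let ?D = "SIGMA m:{1::nat..}. {k. k dvd m}"
  have bij: "bij_betw (\<lambda>(m, k). (k, m div k)) ?D ({1..} \<times> {1::nat..})"
    by (rule bij_betwI[where g = "\<lambda>(k, l). (k * l, k)"])
       (auto simp: Suc_le_eq dvd_pos_nat elim!: dvdE)
  let ?h = "\<lambda>(k, l). ?f k * ?g l"
  have prod: "?h summable_on {1..} \<times> {1..}"
  proof -
    have "(\<lambda>l. norm (?f k * ?g l)) summable_on {1..}" for k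
      using summable_on_cmult_right[OF b, of "?f k"]
      by (rule summable_on_iff_abs_summable_on_real[THEN iffD1])
    moreover have "(\<lambda>k. norm (\<Sum>\<^sub>\<infinity>l\<in>{1..}. norm (?f k * ?g l))) summable_on {1..}"
      unfolding norm_mult infsum_cmult_right'
      by (intro summable_on_cmult_left a summable_on_iff_abs_summable_on_real[THEN iffD1])
    ultimately have "(\<lambda>p. norm (?h p)) summable_on {1..} \<times> {1..}"
      by (subst Infinite_Sum.abs_summable_on_Sigma_iff) auto
    then show ?thesis by (rule abs_summable_summable)
  qed
  let ?h' = "\<lambda>(m, k). ?f k * ?g (m div k)"
  have summ: "?h' summable_on ?D"
    using prod summable_on_reindex_bij_betw[OF bij, of ?h]
    by (simp add: case_prod_unfold)
  have inner: "(\<Sum>\<^sub>\<infinity>k\<in>{k. k dvd m}. ?f k * ?g (m div k)) = real_of_int (dirichlet_conv a b m) / real m ^ s"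
    if "m \<in> {1..}" for m
  proof -
    have "finite {k. k dvd m}" using that by simp
    then have "(\<Sum>\<^sub>\<infinity>k\<in>{k. k dvd m}. ?f k * ?g (m div k)) = (\<Sum>k | k dvd m. ?f k * ?g (m div k))"
      by simp
    also have "\<dots> = (\<Sum>k | k dvd m. real_of_int (a k * b (m div k)) / real m ^ s)"
    proof (rule sum.cong[OF refl])
      fix k assume "k \<in> {k. k dvd m}"
      then have "real m ^ s = real k ^ s * real (m div k) ^ s"
        by (auto simp flip: of_nat_mult power_mult_distrib)
      then show "?f k * ?g (m div k) = real_of_int (a k * b (m div k)) / real m ^ s" by simp
    qed
    finally show ?thesis by (simp add: dirichlet_conv_def sum_divide_distrib)
  qed
  have "(\<lambda>m. \<Sum>\<^sub>\<infinity>k\<in>{k. k dvd m}. ?f k * ?g (m div k)) summable_on {1..}"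
    using summable_on_Sigma_banach[OF summ] by simp
  then have "(\<lambda>m. real_of_int (dirichlet_conv a b m) / real m ^ s) summable_on {1..}"
    by (rule summable_on_cong[THEN iffD1, rotated]) (use inner in auto)
  then show ?S .
  have "(\<Sum>\<^sub>\<infinity>k\<in>{1..}. real_of_int (dirichlet_conv a b k) / real k ^ s) =
      (\<Sum>\<^sub>\<infinity>m\<in>{1..}. \<Sum>\<^sub>\<infinity>k\<in>{k. k dvd m}. ?f k * ?g (m div k))"
    by (intro infsum_cong inner[symmetric])
  also have "\<dots> = infsum ?h' ?D"
    by (rule infsum_Sigma'_banach[OF summ])
  also have "\<dots> = infsum ?h ({1..} \<times> {1..})"
    using infsum_reindex_bij_betw[OF bij, of ?h] by (simp add: case_prod_unfold)
  also have "\<dots> = (\<Sum>\<^sub>\<infinity>k\<in>{1..}. \<Sum>\<^sub>\<infinity>l\<in>{1..}. ?f k * ?g l)"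
    by (rule infsum_Sigma'_banach[symmetric, OF prod])
  also have "\<dots> = infsum ?f {1..} * infsum ?g {1..}"
    by (simp only: infsum_cmult_right' infsum_cmult_left')
  finally show ?E .
qed

lemma summable_on_inverse_power:
  assumes "s \<ge> 2"
  shows "(\<lambda>k. 1 / real k ^ s) summable_on {1..}"
proof -
  have "summable (\<lambda>k. norm ((1 / real k ^ s)))"
    using inverse_power_summable[OF assms, where ?'a = real] by (simp add: field_simps)
  then have "(\<lambda>k. 1 / real k ^ s) summable_on UNIV"
    by (rule norm_summable_imp_summable_on)
  then show ?thesis by (rule summable_on_subset_banach) simp
qed

lemma summable_on_moebius_series:
  assumes "s \<ge> 2"
  shows "(\<lambda>k. real_of_int (moebius k) / real k ^ s) summable_on {1..}"
proof (rule abs_summable_summable, rule Infinite_Sum.abs_summable_on_comparison_test'[OF summable_on_inverse_power[OF assms]])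
  fix k :: nat
  have "\<bar>real_of_int (moebius k)\<bar> \<le> 1" by (simp add: moebius_def)
  then show "norm (real_of_int (moebius k) / real k ^ s) \<le> 1 / real k ^ s"
    by (simp add: divide_right_mono)
qed

text \<open>Connects the complex series in \<open>is_zeta\<close>, indexed from 0, with the real
  unordered sums over k >= 1 used for Dirichlet products.\<close>

lemma zeta_of_nat:
  assumes "s \<ge> 2"
  shows "zeta (of_nat s) = of_real (\<Sum>\<^sub>\<infinity>k\<in>{1..}. 1 / real k ^ s)"
proof -
  have "((\<lambda>k. 1 / real k ^ s) has_sum (\<Sum>\<^sub>\<infinity>k\<in>{1..}. 1 / real k ^ s)) {1..}"
    by (intro has_sum_infsum summable_on_inverse_power assms)
  moreover have bij: "bij_betw Suc UNIV {1..}"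
    by (rule bij_betwI[where g = "\<lambda>n. n - 1"]) auto
  ultimately have "((\<lambda>k. 1 / real (Suc k) ^ s) has_sum (\<Sum>\<^sub>\<infinity>k\<in>{1..}. 1 / real k ^ s)) UNIV"
    using has_sum_reindex_bij_betw[OF bij, of "\<lambda>k. 1 / real k ^ s"] by (simp only:)
  then have "(\<lambda>k. 1 / real (Suc k) ^ s) sums (\<Sum>\<^sub>\<infinity>k\<in>{1..}. 1 / real k ^ s)"
    by (rule has_sum_imp_sums)
  then have "(\<lambda>k. of_real (1 / real (Suc k) ^ s) :: complex) sums of_real (\<Sum>\<^sub>\<infinity>k\<in>{1..}. 1 / real k ^ s)"
    by (rule sums_of_real)
  moreover have "of_real (1 / real (Suc k) ^ s) = (1 / of_nat (Suc k) powr of_nat s :: complex)" for k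
    by (simp add: powr_nat' del: of_nat_Suc)
  ultimately have "(\<lambda>k. 1 / of_nat (Suc k) powr of_nat s :: complex) sums of_real (\<Sum>\<^sub>\<infinity>k\<in>{1..}. 1 / real k ^ s)"
    by simp
  moreover have "zeta (of_nat s) = (\<Sum>k. 1 / of_nat (Suc k) powr of_nat s)"
    using is_zeta_zeta assms unfolding is_zeta_def by simp
  ultimately show ?thesis by (simp only: sums_iff)
qed

text \<open>The convolution of \<open>moebius\<close> with the constant 1 is the convolution unit,
  so only the term k = 1 survives.\<close>

lemma moebius_series_mult_zeta:
  assumes "s \<ge> 2"
  shows "(\<Sum>\<^sub>\<infinity>k\<in>{1..}. real_of_int (moebius k) / real k ^ s) * (\<Sum>\<^sub>\<infinity>k\<in>{1..}. 1 / real k ^ s) = 1"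
proof -
  have "(\<Sum>\<^sub>\<infinity>k\<in>{1..}. real_of_int (moebius k) / real k ^ s) * (\<Sum>\<^sub>\<infinity>k\<in>{1..}. 1 / real k ^ s) =
      (\<Sum>\<^sub>\<infinity>k\<in>{1..}. real_of_int (dirichlet_conv moebius (\<lambda>_. 1) k) / real k ^ s)"
    using dirichlet_series_conv(2)[OF summable_on_moebius_series[OF assms], of "\<lambda>_. 1"]
      summable_on_inverse_power[OF assms] by simp
  also have "\<dots> = (\<Sum>\<^sub>\<infinity>k\<in>{1::nat}. 1)"
    by (rule infsum_cong_neutral) (auto simp: dirichlet_conv_moebius_1)
  finally show ?thesis by simp
qed

lemma moebius_conv_series:
  assumes "q \<ge> 1" "s \<ge> 2"
  shows "(\<lambda>k. real_of_int (moebius_conv q k) / real k ^ s) summable_on {1..}"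
    and "(\<Sum>\<^sub>\<infinity>k\<in>{1..}. real_of_int (moebius_conv q k) / real k ^ s) =
      (\<Sum>\<^sub>\<infinity>k\<in>{1..}. real_of_int (moebius k) / real k ^ s) ^ q"
proof -
  have "(\<lambda>k. real_of_int (moebius_conv q k) / real k ^ s) summable_on {1..} \<and>
    (\<Sum>\<^sub>\<infinity>k\<in>{1..}. real_of_int (moebius_conv q k) / real k ^ s) =
      (\<Sum>\<^sub>\<infinity>k\<in>{1..}. real_of_int (moebius k) / real k ^ s) ^ q"
    using assms(1)
  proof (induction q rule: dec_induct)
    case base
    then show ?case using summable_on_moebius_series[OF assms(2)] by (simp add: moebius_conv_def)
  next
    case (step q)
    \<comment> \<open>The iteration count in \<open>moebius_conv\<close> is q - 1 in truncated
      subtraction, so the unfolding relies on q >= 1 from the induction.\<close>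
    have "moebius_conv (Suc q) = dirichlet_conv moebius (moebius_conv q)"
      using step.hyps by (cases q) (auto simp: moebius_conv_def)
    then show ?case
      using dirichlet_series_conv[OF summable_on_moebius_series[OF assms(2)], of "moebius_conv q"] step.IH
      by simp
  qed
  then show "(\<lambda>k. real_of_int (moebius_conv q k) / real k ^ s) summable_on {1..}"
    and "(\<Sum>\<^sub>\<infinity>k\<in>{1..}. real_of_int (moebius_conv q k) / real k ^ s) =
      (\<Sum>\<^sub>\<infinity>k\<in>{1..}. real_of_int (moebius k) / real k ^ s) ^ q" by auto
qed

text \<open>The inverse of zeta(s) is the Moebius series, and its q-th power is the series of the
  q-fold convolution. The values are real, so the theorem reduces to a real identity.\<close>

lemma zeta_powi_neg:
  assumes "q \<ge> 1" "s \<ge> 2"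
  shows "zeta (of_nat s) powi (- int q) =
    of_real (\<Sum>\<^sub>\<infinity>k\<in>{1..}. real_of_int (moebius_conv q k) / real k ^ s)"
proof -
  have "inverse (\<Sum>\<^sub>\<infinity>k\<in>{1..}. 1 / real k ^ s) = (\<Sum>\<^sub>\<infinity>k\<in>{1..}. real_of_int (moebius k) / real k ^ s)"
    using moebius_series_mult_zeta[OF assms(2)] by (metis inverse_unique mult.commute)
  then show ?thesis
    unfolding zeta_of_nat[OF assms(2)] moebius_conv_series(2)[OF assms] power_int_minus
    by (simp only: power_int_of_nat of_real_power flip: power_inverse of_real_inverse)
qed

section \<open>Splitting the frequencies at n\<close>

text \<open>One factor (n/k)^2 is reserved to make the sum over k converge, hence the exponent
  \<open>Suc j\<close>; the other j factors are bounded uniformly in k by a geometric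
  sequence.\<close>

lemma summable_tail_series:
  fixes w :: "nat \<Rightarrow> real"
  assumes w: "(\<lambda>k. w k / real k ^ 2) summable_on {1..}"
  shows "summable (\<lambda>j. \<bar>\<Sum>\<^sub>\<infinity>k\<in>{n<..}. w k * ((real n / real k)\<^sup>2) ^ Suc j\<bar>)"
proof -
  \<comment> \<open>The largest ratio (n/k)^2 over k > n, attained at k = n + 1.\<close>
  define \<theta> where "\<theta> = (real n / real (Suc n))\<^sup>2"
  have \<theta>: "0 \<le> \<theta>" "\<theta> < 1"
    unfolding \<theta>_def abs_square_less_1 by simp_all
  let ?g = "\<lambda>k. \<bar>w k\<bar> * (real n / real k)\<^sup>2"
  have "(\<lambda>k. norm (w k / real k ^ 2) * (real n)\<^sup>2) summable_on {n<..}"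
    by (intro summable_on_cmult_left
        summable_on_subset_banach[OF w[THEN summable_on_iff_abs_summable_on_real[THEN iffD1]]]) auto
  moreover have "norm (w k / real k ^ 2) * (real n)\<^sup>2 = ?g k" for k
    by (simp add: power_divide)
  ultimately have g: "?g summable_on {n<..}" by (simp only:)
  have le: "norm (w k * ((real n / real k)\<^sup>2) ^ Suc j) \<le> ?g k * \<theta> ^ j" if "k \<in> {n<..}" for k j
  proof -
    have "(real n / real k)\<^sup>2 \<le> \<theta>"
      unfolding \<theta>_def using that by (intro power_mono frac_le) auto
    then have "((real n / real k)\<^sup>2) ^ j \<le> \<theta> ^ j" by (intro power_mono) auto
    then have "?g k * ((real n / real k)\<^sup>2) ^ j \<le> ?g k * \<theta> ^ j" by (intro mult_left_mono) auto
    then show ?thesis by (simp add: abs_mult mult.assoc)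
  qed
  have g': "(\<lambda>k. ?g k * \<theta> ^ j) summable_on {n<..}" for j
    by (intro summable_on_cmult_left g)
  have f: "(\<lambda>k. norm (w k * ((real n / real k)\<^sup>2) ^ Suc j)) summable_on {n<..}" for j
    by (rule summable_on_comparison_test[OF g']) (use le in auto)
  show ?thesis
  proof (rule summable_comparison_test')
    show "summable (\<lambda>j. infsum ?g {n<..} * \<theta> ^ j)"
      using \<theta> by (intro summable_mult summable_geometric) auto
    fix j
    have "\<bar>\<Sum>\<^sub>\<infinity>k\<in>{n<..}. w k * ((real n / real k)\<^sup>2) ^ Suc j\<bar> \<le>
        (\<Sum>\<^sub>\<infinity>k\<in>{n<..}. norm (w k * ((real n / real k)\<^sup>2) ^ Suc j))"
      using norm_infsum_bound[OF f] by simp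
    also have "\<dots> \<le> (\<Sum>\<^sub>\<infinity>k\<in>{n<..}. ?g k * \<theta> ^ j)"
      by (rule infsum_mono[OF f g' le])
    also have "\<dots> = infsum ?g {n<..} * \<theta> ^ j" by (rule infsum_cmult_left')
    finally show "norm \<bar>\<Sum>\<^sub>\<infinity>k\<in>{n<..}. w k * ((real n / real k)\<^sup>2) ^ Suc j\<bar> \<le> infsum ?g {n<..} * \<theta> ^ j"
      by simp
  qed
qed

text \<open>The argument is linear in the coefficients \<open>w\<close>, so it is carried out for
  any \<open>w\<close> with summable series. The constant \<open>c\<close> may be any real: it
  enters the absolutely convergent part, whose product with the sinc coefficients sums to 0.\<close>

lemma sinc_conv_dirichlet_series_sums:
  fixes w :: "nat \<Rightarrow> real"
  assumes n: "n \<ge> 1" and w: "\<And>s. s \<ge> 2 \<Longrightarrow> (\<lambda>k. w k / real k ^ s) summable_on {1..}"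
  shows "(\<lambda>i. \<Sum>j\<le>i. sinc_coeff (2 * pi * real n) (i - j) *
      (if j = 0 then c else real n ^ (2 * j) * (\<Sum>\<^sub>\<infinity>k\<in>{1..}. w k / real k ^ (2 * j)))) sums (- w n / 2)"
proof -
  let ?s = "sinc_coeff (2 * pi * real n)" and ?r = "\<lambda>k. (real n / real k)\<^sup>2"
  let ?g = "\<lambda>j k. if j = 0 then 0 else ?r k ^ j"
  define t where "t = (\<lambda>j. if j = 0 then c else (\<Sum>\<^sub>\<infinity>k\<in>{n<..}. w k * ?r k ^ j))"
  have split: "(if j = 0 then c else real n ^ (2 * j) * (\<Sum>\<^sub>\<infinity>k\<in>{1..}. w k / real k ^ (2 * j))) =
      t j + (\<Sum>k=1..n. w k * ?g j k)" for j
  proof (cases "j = 0")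
    case False
    have eq: "real n ^ (2 * j) * (w k / real k ^ (2 * j)) = w k * ?r k ^ j" for k
      by (simp add: power_divide power_mult)
    have "(\<lambda>k. w k / real k ^ (2 * j)) summable_on {1..}"
      using False by (intro w) auto
    then have "(\<lambda>k. real n ^ (2 * j) * (w k / real k ^ (2 * j))) summable_on {1..}"
      by (rule summable_on_cmult_right)
    then have summ: "(\<lambda>k. w k * ?r k ^ j) summable_on {1..}" unfolding eq .
    have un: "{1..} = {1..n} \<union> {n<..}" using n by auto
    have "real n ^ (2 * j) * (\<Sum>\<^sub>\<infinity>k\<in>{1..}. w k / real k ^ (2 * j)) = (\<Sum>\<^sub>\<infinity>k\<in>{1..}. w k * ?r k ^ j)"
      unfolding eq[symmetric] by (rule infsum_cmult_right'[symmetric])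
    also have "\<dots> = (\<Sum>\<^sub>\<infinity>k\<in>{1..n}. w k * ?r k ^ j) + (\<Sum>\<^sub>\<infinity>k\<in>{n<..}. w k * ?r k ^ j)"
      unfolding un
      by (intro infsum_Un_disjoint summable_on_subset_banach[OF summ]) (use n in auto)
    finally show ?thesis using False by (simp add: t_def)
  qed (simp add: t_def)
  have "summable (\<lambda>j. \<bar>t (Suc j)\<bar>)"
    using summable_tail_series[OF w, of n] by (simp add: t_def)
  then have t: "summable (\<lambda>j. \<bar>t j\<bar>)" by (subst (asm) summable_Suc_iff)
  \<comment> \<open>The sequence \<open>t\<close> contributes 0. The finitely many frequencies k <=
    n are summed one at a time, and only k = n leaves -1/2.\<close>
  have "(\<lambda>i. (\<Sum>j\<le>i. ?s (i - j) * t j) + (\<Sum>k=1..n. w k * geom_conv ?s (?r k) i)) sums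
      (0 + (\<Sum>k=1..n. w k * (if k = n then - 1 / 2 else 0)))"
    by (intro sums_add cauchy_zero_sums summable_abs_sinc_coeff t sinc_coeff_two_pi_sums n
        sums_sum sums_mult geom_conv_sinc_coeff_sums) auto
  moreover have "(\<Sum>k=1..n. w k * (if k = n then - 1 / 2 else 0)) = - w n / 2"
    using n by (simp add: if_distrib[of "\<lambda>x. _ * x"] cong: if_cong)
  moreover have "(\<Sum>j\<le>i. ?s (i - j) * t j) + (\<Sum>k=1..n. w k * geom_conv ?s (?r k) i) =
      (\<Sum>j\<le>i. ?s (i - j) * (t j + (\<Sum>k=1..n. w k * ?g j k)))" for i
  proof -
    have "(\<Sum>k=1..n. w k * geom_conv ?s (?r k) i) = (\<Sum>k=1..n. \<Sum>j\<le>i. ?s (i - j) * (w k * ?g j k))"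
      by (simp add: geom_conv_def sum_distrib_left mult.left_commute)
    also have "\<dots> = (\<Sum>j\<le>i. \<Sum>k=1..n. ?s (i - j) * (w k * ?g j k))" by (rule sum.swap)
    finally show ?thesis by (simp only: distrib_left sum.distrib sum_distrib_left)
  qed
  ultimately show ?thesis unfolding split by simp
qed

text \<open>Convergence is part of the claim, since \<open>suminf\<close> of a divergent series has
  no meaningful value.\<close>

theorem mainTheorem4:
  fixes q n :: nat
  defines "F \<equiv> \<lambda>i. (-1) ^ i * (2 * complex_of_real pi * of_nat n) ^ (2 * i) *
    (\<Sum>j=0..i. (-1) ^ j * (2 * complex_of_real pi) powi (- 2 * int j)
        * zeta (2 * of_nat j) powi (- int q) / fact (2 * i + 1 - 2 * j))"
  assumes "q \<ge> 1" and "n \<ge> 1"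
  shows "summable F \<and> complex_of_int (moebius_conv q n) = - 2 * (\<Sum>i. F i)"
proof -
  let ?s = "sinc_coeff (2 * pi * real n)"
  define w where "w = (\<lambda>k. real_of_int (moebius_conv q k))"
  define b where "b = (\<lambda>j. if j = 0 then (-1 / 2) powi (- int q)
    else real n ^ (2 * j) * (\<Sum>\<^sub>\<infinity>k\<in>{1..}. w k / real k ^ (2 * j)))"
  have b: "of_nat n ^ (2 * j) * zeta (2 * of_nat j) powi (- int q) = complex_of_real (b j)" for j
  proof (cases "j = 0")
    case True
    then show ?thesis by (simp add: b_def zeta_0 power_int_minus)
  next
    case False
    then show ?thesis
      using zeta_powi_neg[OF assms(2), of "2 * j"] by (simp add: b_def w_def)
  qed
  \<comment> \<open>Split (2 pi n)^(2i) into (2 pi n)^(2(i-j)) and (2 pi n)^(2j). The latter cancels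
    (2 pi)^(-2j) and leaves n^(2j), while the signs combine to (-1)^(i-j) and the factorial is
    (2(i-j)+1)!.\<close>
  have F: "F i = of_real (\<Sum>j\<le>i. ?s (i - j) * b j)" for i
  proof -
    have "(-1) ^ i * (2 * complex_of_real pi * of_nat n) ^ (2 * i) *
      ((-1) ^ j * (2 * complex_of_real pi) powi (- 2 * int j) * z / fact (2 * i + 1 - 2 * j)) =
      of_real (?s (i - j)) * (of_nat n ^ (2 * j) * z)" if "j \<le> i" for j z
    proof -
      \<comment> \<open>Writing i = m + j removes the truncated subtractions from the exponents and
        the factorial.\<close>
      obtain m where i: "i = m + j" using \<open>j \<le> i\<close> by (metis le_add_diff_inverse2)
      have powi: "(2 * complex_of_real pi) powi (- 2 * int j) = 1 / (2 * complex_of_real pi) ^ (2 * j)"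
      proof -
        have "- 2 * int j = - int (2 * j)" by simp
        then show ?thesis by (simp only: power_int_minus power_int_of_nat inverse_eq_divide)
      qed
      have sgn: "(-1) ^ (m + j) * (-1) ^ j = ((-1) ^ m :: complex)"
        by (simp add: power_add flip: power_mult_distrib)
      have "2 * (m + j) + 1 - 2 * j = 2 * m + 1" by simp
      then have "(-1) ^ i * (2 * complex_of_real pi * of_nat n) ^ (2 * i) *
        ((-1) ^ j * (2 * complex_of_real pi) powi (- 2 * int j) * z / fact (2 * i + 1 - 2 * j)) =
        ((-1) ^ (m + j) * (-1) ^ j) * (2 * complex_of_real pi * of_nat n) ^ (2 * m) *
        ((2 * complex_of_real pi * of_nat n) ^ (2 * j) / (2 * complex_of_real pi) ^ (2 * j)) *
        z / fact (2 * m + 1)"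
        unfolding powi i by (simp add: distrib_left power_add mult_ac del: fact_Suc)
      also have "(2 * complex_of_real pi * of_nat n) ^ (2 * j) / (2 * complex_of_real pi) ^ (2 * j)
        = of_nat n ^ (2 * j)" by (simp add: power_mult_distrib)
      finally show ?thesis
        unfolding sgn by (simp add: i sinc_coeff_def mult_ac del: fact_Suc)
    qed
    then show ?thesis
      by (simp add: F_def sum_distrib_left atLeast0AtMost b cong: sum.cong_simp)
  qed
  have "(\<lambda>i. \<Sum>j\<le>i. ?s (i - j) * b j) sums (- w n / 2)"
    unfolding b_def w_def
    by (intro sinc_conv_dirichlet_series_sums assms moebius_conv_series(1))
  then have "F sums of_real (- w n / 2)" unfolding F[abs_def] by (rule sums_of_real)
  then show ?thesis by (simp add: sums_iff w_def)
qed

end
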